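(* Let $y\in\mathcal{Y}$ be such that $y_\xi'\ge r_*/2$ for all $\xi\in\mathbb{Z}$. Then $$c(y)\ge\min_{\xi=1,\dots,N}A_\xi\qquad\text{and}\qquad c_{\rm qc}(y)\ge\min_{\xi=1,\dots,N}\tilde A_\xi.$$
   Context: Lattice and spaces. Let $N\in\mathbb{N}$, $\varepsilon=1/N$, $F>0$, $x_\xi=\varepsilon\xi$ for $\xi\in\mathbb{Z}$. Set $\mathcal{U}=\{u\in\mathbb{R}^{\mathbb{Z}}: u_{\xi+N}=u_\xi\ \forall\xi\in\mathbb{Z},\ \sum_{\xi=1}^N u_\xi=0\}$ and $\mathcal{Y}=Fx+\mathcal{U}$. For $v\in\mathbb{R}^{\mathbb{Z}}$, $v_\xi'=\varepsilon^{-1}(v_\xi-v_{\xi-1})$; for $y\in\mathcal{Y}$, $y'$ is $N$-periodic. For $u\in\mathcal{U}$, $\|u\|_{\mathcal{U}^{1,2}}=(\varepsilon\sum_{\xi=1}^N|u_\xi'|^2)^{1/2}$. Potential. $\phi\in C^3((0,+\infty];\mathbb{R})$, meaning that $\phi$ is $C^3$ on $(0,\infty)$ and $\phi$ and its first three derivatives are bounded on $(\delta,+\infty)$ for every $\delta>0$; there is $r_*>0$ such that $\phi$ is convex in $(0,r_* )$ and concave in $(r_*,+\infty)$. Regions. $\mathcal{A}\subset\{1,\dots,N\}$ is the atomistic region, $\mathcal{C}=\{1,\dots,N\}\setminus\mathcal{A}$ the continuum region, $\mathcal{A}_\#=\bigcup_{j\in\mathbb{Z}}(Nj+\mathcal{A})$.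 Let $\mathcal{I}_\ell=\{\xi\in\mathcal{C}:\xi+1\in\mathcal{A}_\#\}$, $\mathcal{I}_r=\{\xi\in\mathcal{C}:\xi-1\in\mathcal{A}_\#\}$; it is assumed that $\mathcal{I}_\ell\cap\mathcal{I}_r=\emptyset$. Further, $\mathcal{I}_\ell'=\mathcal{I}_\ell+1$ (indices modulo $N$), $\mathcal{I}_r'=\mathcal{I}_r$, $\mathcal{I}'=\mathcal{I}_\ell'\cup\mathcal{I}_r'$, $\mathcal{A}'=\mathcal{A}\setminus\mathcal{I}_\ell'$, $\mathcal{C}'=\mathcal{C}\cup\mathcal{I}_\ell'$. Energies. For $y\in\mathcal{Y}$ with $y_\xi'>0$ for all $\xi$, $$\Phi(y)=\varepsilon\sum_{\xi=1}^N\big(\phi(y_\xi')+\phi(y_\xi'+y_{\xi+1}')\big),$$ $$\Phi_{\rm qc}(y)=\varepsilon\sum_{\xi=1}^N\phi(y_\xi')+\varepsilon\sum_{\xi\in\mathcal{A}}\phi(y_\xi'+y_{\xi+1}')+\varepsilon\sum_{\xi\in\mathcal{C}}\tfrac12\{\phi(2y_\xi')+\phi(2y_{\xi+1}')\},$$ with second variations $D^2\Phi(y)$, $D^2\Phi_{\rm qc}(y)$ (symmetric bilinear forms on $\mathcal{U}\times\mathcal{U}$) and stability constants $$c(y)=\inf_{u\in\mathcal{U},\ \|u\|_{\mathcal{U}^{1,2}}=1}D^2\Phi(y)[u,u],\qquad c_{\rm qc}(y)=\inf_{u\in\mathcal{U},\ \|u\|_{\mathcal{U}^{1,2}}=1}D^2\Phi_{\rm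 qc}(y)[u,u].$$ Coefficients. $A_\xi=\phi''(y_\xi')+2\phi''(y_{\xi-1}'+y_\xi')+2\phi''(y_\xi'+y_{\xi+1}')$, and $$\tilde A_\xi=\phi''(y_\xi')+\begin{cases}2\phi''(y_{\xi-1}'+y_\xi')+2\phi''(y_\xi'+y_{\xi+1}'),&\xi\in\mathcal{A}',\\ 2\phi''(y_{\xi-1}'+y_\xi')+2\phi''(2y_\xi'),&\xi\in\mathcal{I}_r',\\ 2\phi''(y_\xi'+y_{\xi+1}')+2\phi''(2y_\xi'),&\xi\in\mathcal{I}_\ell',\\ 4\phi''(2y_\xi'),&\xi\in\mathcal{C}'\setminus\mathcal{I}'.\end{cases}$$ *)

theory Defs
  imports "HOL-Analysis.Analysis"
begin

section \<open>Lattice and function spaces\<close>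

definition eps :: "nat \<Rightarrow> real" where
  "eps N = 1 / real N"

definition mean_zero_periodic :: "nat \<Rightarrow> (int \<Rightarrow> real) set" where
  "mean_zero_periodic N =
     {u. (\<forall>\<xi>. u (\<xi> + int N) = u \<xi>) \<and> (\<Sum>\<xi>\<in>{1..int N}. u \<xi>) = 0}"

definition deformations :: "nat \<Rightarrow> real \<Rightarrow> (int \<Rightarrow> real) set" where
  "deformations N F =
     {(\<lambda>\<xi>. F * (eps N * of_int \<xi>) + u \<xi>) | u. u \<in> mean_zero_periodic N}"

definition bdiff :: "nat \<Rightarrow> (int \<Rightarrow> real) \<Rightarrow> int \<Rightarrow> real" where
  "bdiff N v \<xi> = (v \<xi> - v (\<xi> - 1)) / eps N"

definition norm_U12 :: "nat \<Rightarrow> (int \<Rightarrow> real) \<Rightarrow> real" where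
  "norm_U12 N u = sqrt (eps N * (\<Sum>\<xi>\<in>{1..int N}. \<bar>bdiff N u \<xi>\<bar>\<^sup>2))"

section \<open>Interaction potential\<close>

text \<open>Potentials are total functions on the reals, but only their values on
  the positive half-line matter. The closed right end of the interval in
  \<open>C\<^sup>3((0,+\<infinity>])\<close> stands for boundedness of the function and its first
  three derivatives away from the origin.\<close>

definition C3_potential :: "(real \<Rightarrow> real) \<Rightarrow> bool" where
  "C3_potential \<phi> \<longleftrightarrow>
     (\<forall>k<3. (deriv ^^ k) \<phi> differentiable_on {0<..}) \<and>
     continuous_on {0<..} ((deriv ^^ 3) \<phi>) \<and>
     (\<forall>\<delta>>0. \<forall>k\<le>3. bounded ((deriv ^^ k) \<phi> ` {\<delta><..}))"

section \<open>Atomistic, continuum and interface regions\<close>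

definition periodic_ext :: "nat \<Rightarrow> int set \<Rightarrow> int set" where
  "periodic_ext N A = (\<Union>j. (\<lambda>\<xi>. int N * j + \<xi>) ` A)"

definition cont_region :: "nat \<Rightarrow> int set \<Rightarrow> int set" where
  "cont_region N A = {1..int N} - A"

definition iface_l :: "nat \<Rightarrow> int set \<Rightarrow> int set" where
  "iface_l N A = {\<xi> \<in> cont_region N A. \<xi> + 1 \<in> periodic_ext N A}"

definition iface_r :: "nat \<Rightarrow> int set \<Rightarrow> int set" where
  "iface_r N A = {\<xi> \<in> cont_region N A. \<xi> - 1 \<in> periodic_ext N A}"

text \<open>The map \<open>\<xi> \<mapsto> \<xi> mod N + 1\<close> is the cyclic successor on \<open>{1..N}\<close>.\<close>

definition iface_l' :: "nat \<Rightarrow> int set \<Rightarrow> int set" where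
  "iface_l' N A = (\<lambda>\<xi>. \<xi> mod int N + 1) ` iface_l N A"

definition iface_r' :: "nat \<Rightarrow> int set \<Rightarrow> int set" where
  "iface_r' N A = iface_r N A"

definition iface' :: "nat \<Rightarrow> int set \<Rightarrow> int set" where
  "iface' N A = iface_l' N A \<union> iface_r' N A"

definition atom_region' :: "nat \<Rightarrow> int set \<Rightarrow> int set" where
  "atom_region' N A = A - iface_l' N A"

definition cont_region' :: "nat \<Rightarrow> int set \<Rightarrow> int set" where
  "cont_region' N A = cont_region N A \<union> iface_l' N A"

section \<open>Energies, second variations and stability constants\<close>

definition energy :: "nat \<Rightarrow> (real \<Rightarrow> real) \<Rightarrow> (int \<Rightarrow> real) \<Rightarrow> real" where
  "energy N \<phi> y = eps N *
     (\<Sum>\<xi>\<in>{1..int N}. \<phi> (bdiff N y \<xi>) + \<phi> (bdiff N y \<xi> + bdiff N y (\<xi> + 1)))"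

definition energy_qc ::
  "nat \<Rightarrow> int set \<Rightarrow> (real \<Rightarrow> real) \<Rightarrow> (int \<Rightarrow> real) \<Rightarrow> real" where
  "energy_qc N A \<phi> y =
     eps N * (\<Sum>\<xi>\<in>{1..int N}. \<phi> (bdiff N y \<xi>))
     + eps N * (\<Sum>\<xi>\<in>A. \<phi> (bdiff N y \<xi> + bdiff N y (\<xi> + 1)))
     + eps N * (\<Sum>\<xi>\<in>cont_region N A.
         1 / 2 * (\<phi> (2 * bdiff N y \<xi>) + \<phi> (2 * bdiff N y (\<xi> + 1))))"

text \<open>\<open>D\<^sup>2E(y)[u,v]\<close> as an iterated directional derivative. Only the values of
  \<open>E\<close> near \<open>y\<close> matter, so it is immaterial how
  the energies are extended to deformations with nonpositive strain.\<close>

definition second_variation ::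
  "((int \<Rightarrow> real) \<Rightarrow> real) \<Rightarrow> (int \<Rightarrow> real) \<Rightarrow> (int \<Rightarrow> real) \<Rightarrow> (int \<Rightarrow> real) \<Rightarrow> real" where
  "second_variation E y u v =
     deriv (\<lambda>s. deriv (\<lambda>t. E (\<lambda>\<xi>. y \<xi> + s * u \<xi> + t * v \<xi>)) 0) 0"

text \<open>The infimum is taken in the extended reals: for \<open>N = 1\<close> the space of
  test functions is trivial and the constraint set is empty.\<close>

definition stability_const ::
  "nat \<Rightarrow> ((int \<Rightarrow> real) \<Rightarrow> real) \<Rightarrow> (int \<Rightarrow> real) \<Rightarrow> ereal" where
  "stability_const N E y =
     (INF u \<in> {u \<in> mean_zero_periodic N. norm_U12 N u = 1}.
        ereal (second_variation E y u u))"

section \<open>Coefficients\<close>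

definition coeff_at :: "nat \<Rightarrow> (real \<Rightarrow> real) \<Rightarrow> (int \<Rightarrow> real) \<Rightarrow> int \<Rightarrow> real" where
  "coeff_at N \<phi> y \<xi> =
     (deriv ^^ 2) \<phi> (bdiff N y \<xi>)
     + 2 * (deriv ^^ 2) \<phi> (bdiff N y (\<xi> - 1) + bdiff N y \<xi>)
     + 2 * (deriv ^^ 2) \<phi> (bdiff N y \<xi> + bdiff N y (\<xi> + 1))"

text \<open>The last branch is the case \<open>\<xi> \<in> \<C>' - \<I>'\<close>; by the lemma
  \<open>regions_partition\<close> below the four cases partition \<open>{1..N}\<close>, so the
  order of the tests is irrelevant.\<close>

definition coeff_qc ::
  "nat \<Rightarrow> int set \<Rightarrow> (real \<Rightarrow> real) \<Rightarrow> (int \<Rightarrow> real) \<Rightarrow> int \<Rightarrow> real" where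
  "coeff_qc N A \<phi> y \<xi> =
     (deriv ^^ 2) \<phi> (bdiff N y \<xi>) +
     (if \<xi> \<in> atom_region' N A then
        2 * (deriv ^^ 2) \<phi> (bdiff N y (\<xi> - 1) + bdiff N y \<xi>)
        + 2 * (deriv ^^ 2) \<phi> (bdiff N y \<xi> + bdiff N y (\<xi> + 1))
      else if \<xi> \<in> iface_r' N A then
        2 * (deriv ^^ 2) \<phi> (bdiff N y (\<xi> - 1) + bdiff N y \<xi>)
        + 2 * (deriv ^^ 2) \<phi> (2 * bdiff N y \<xi>)
      else if \<xi> \<in> iface_l' N A then
        2 * (deriv ^^ 2) \<phi> (bdiff N y \<xi> + bdiff N y (\<xi> + 1))
        + 2 * (deriv ^^ 2) \<phi> (2 * bdiff N y \<xi>)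
      else 4 * (deriv ^^ 2) \<phi> (2 * bdiff N y \<xi>))"

lemma iface_l'_subset:
  assumes "A \<subseteq> {1..int N}"
  shows "iface_l' N A \<subseteq> A"
proof
  fix \<eta> assume "\<eta> \<in> iface_l' N A"
  then obtain \<xi> where \<xi>: "\<xi> \<in> iface_l N A" and \<eta>: "\<eta> = \<xi> mod int N + 1"
    by (auto simp: iface_l'_def)
  obtain a j where a: "a \<in> A" and e: "\<xi> + 1 = int N * j + a"
    using \<xi> by (auto simp: iface_l_def periodic_ext_def)
  have "\<xi> = (a - 1) + int N * j" using e by simp
  then have "\<xi> mod int N = (a - 1) mod int N" by simp
  also have "\<dots> = a - 1" using a assms by (intro mod_pos_pos_trivial) auto
  finally show "\<eta> \<in> A" using a \<eta> by simp
qed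

lemma regions_partition:
  assumes "A \<subseteq> {1..int N}"
  shows "atom_region' N A \<union> iface_r' N A \<union> iface_l' N A
           \<union> (cont_region' N A - iface' N A) = {1..int N}"
    and "atom_region' N A \<inter> iface_r' N A = {}"
    and "atom_region' N A \<inter> iface_l' N A = {}"
    and "iface_r' N A \<inter> iface_l' N A = {}"
    and "(atom_region' N A \<union> iface_r' N A \<union> iface_l' N A)
           \<inter> (cont_region' N A - iface' N A) = {}"
  using assms iface_l'_subset[OF assms]
  by (auto simp: atom_region'_def iface_r'_def iface_r_def cont_region'_def
      cont_region_def iface'_def)

end

theory Submission imports Defs begin

text \<open>The purely atomistic energy is the quasicontinuum energy without continuum region, so only
  the latter has to be treated. All strains are at least \<open>r / 2\<close>, hence all second-neighbour
  distances are at least \<open>r\<close>, where \<open>\<phi>'' \<le> 0\<close>. There \<open>(a + b)\<^sup>2 \<le> 2 a\<^sup>2 + 2 b\<^sup>2\<close> bounds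
  every nonlocal term of the second variation from below by a diagonal one, and collecting the
  coefficient of each \<open>\<bar>u'\<^sub>\<xi>\<bar>\<^sup>2\<close> over one period gives the stated coefficients.\<close>

section \<open>Second derivatives of the potential\<close>

lemma C3_potential_derivs:
  assumes "C3_potential \<phi>" "x > 0"
  shows "(\<phi> has_real_derivative deriv \<phi> x) (at x)"
    and "(deriv \<phi> has_real_derivative (deriv ^^ 2) \<phi> x) (at x)"
    and "isCont ((deriv ^^ 2) \<phi>) x"
proof -
  have d: "((deriv ^^ k) \<phi>) differentiable (at x)" if "k < 3" for k
    using assms that unfolding C3_potential_def
    by (metis differentiable_on_eq_differentiable_at open_greaterThan greaterThan_iff)
  show "(\<phi> has_real_derivative deriv \<phi> x) (at x)"
    using d[of 0] by (simp add: DERIV_deriv_iff_real_differentiable)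
  show "(deriv \<phi> has_real_derivative (deriv ^^ 2) \<phi> x) (at x)"
    using d[of 1] by (simp add: DERIV_deriv_iff_real_differentiable numeral_2_eq_2)
  show "isCont ((deriv ^^ 2) \<phi>) x"
    using d[of 2] differentiable_imp_continuous_within by fastforce
qed

text \<open>Adding the tangent inequalities at two points makes \<open>f'\<close> nonincreasing on
  the half-line, whereas \<open>D > 0\<close> would make \<open>f'\<close> strictly larger just to
  the right of \<open>x\<close>.\<close>

lemma concave_on_imp_second_deriv_nonpos:
  fixes f f' :: "real \<Rightarrow> real"
  assumes conc: "concave_on {r<..} f"
    and f': "\<And>x. x > r \<Longrightarrow> (f has_real_derivative f' x) (at x)"
    and f'': "(f' has_real_derivative D) (at x)" and x: "x > r"
  shows "D \<le> 0"
proof -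
  have tan: "- f z + f w \<ge> - f' w * (z - w)" if "w > r" "z > r" for w z
    using convex_on_imp_above_tangent[of "{r<..}" "\<lambda>x. - f x" w z "- f' w"] conc that f'[of w]
    by (auto simp: concave_on_def interior_open intro!: derivative_eq_intros
        intro: has_field_derivative_at_within)
  have anti: "f' z \<le> f' w" if "w > r" "w < z" for w z
  proof -
    have "(f' z - f' w) * (z - w) \<le> 0"
      using tan[of w z] tan[of z w] that by (simp add: algebra_simps)
    then show ?thesis using that by (simp add: mult_le_0_iff)
  qed
  show ?thesis
  proof (rule ccontr)
    assume "\<not> D \<le> 0"
    then obtain d where "d > 0" "\<And>h. 0 < h \<Longrightarrow> h < d \<Longrightarrow> f' x < f' (x + h)"
      using DERIV_pos_inc_right[OF f''] by auto
    then have "f' x < f' (x + d / 2)" by simp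
    with anti[of x "x + d / 2"] x \<open>d > 0\<close> show False by simp
  qed
qed

lemma C3_potential_concave_nonpos:
  assumes "C3_potential \<phi>" "r > 0" "concave_on {r<..} \<phi>" "x \<ge> r"
  shows "(deriv ^^ 2) \<phi> x \<le> 0"
proof -
  have gt: "(deriv ^^ 2) \<phi> z \<le> 0" if "z > r" for z
  proof (rule concave_on_imp_second_deriv_nonpos[OF assms(3) _ _ that])
    show "(\<phi> has_real_derivative deriv \<phi> x) (at x)" if "x > r" for x
      using that assms(2) by (intro C3_potential_derivs(1)[OF assms(1)]) simp
    show "(deriv \<phi> has_real_derivative (deriv ^^ 2) \<phi> z) (at z)"
      using that assms(2) by (intro C3_potential_derivs(2)[OF assms(1)]) simp
  qed
  \<comment> \<open>The endpoint matters: two strains equal to \<open>r / 2\<close> add up to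
    exactly \<open>r\<close>, which the open interval of concavity misses. Continuity of the second
    derivative carries the sign over from the right.\<close>
  have "((deriv ^^ 2) \<phi> \<longlongrightarrow> (deriv ^^ 2) \<phi> r) (at_right r)"
    using C3_potential_derivs(3)[OF assms(1,2)]
    by (auto simp: isCont_def intro: tendsto_mono[OF at_le])
  then have "(deriv ^^ 2) \<phi> r \<le> 0"
    by (rule tendsto_upperbound)
       (auto intro!: eventually_at_rightI[of r "r + 1"] gt)
  then show ?thesis using gt assms(4) by (cases "x = r") auto
qed

section \<open>Second derivatives of the energies\<close>

text \<open>A relation rather than iterated \<open>deriv\<close>, so that existence is carried along
  through sums and multiples. The first derivative is demanded only near 0, since a perturbed strain
  stays positive only for small parameters.\<close>

definition second_deriv_at_0 :: "(real \<Rightarrow> real) \<Rightarrow> real \<Rightarrow> bool" where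
  "second_deriv_at_0 g D \<longleftrightarrow>
     (\<exists>g'. (\<forall>\<^sub>F s in nhds 0. (g has_real_derivative g' s) (at s)) \<and>
           (g' has_real_derivative D) (at 0))"

lemma second_deriv_at_0_add:
  assumes "second_deriv_at_0 f C" "second_deriv_at_0 g D"
  shows "second_deriv_at_0 (\<lambda>t. f t + g t) (C + D)"
proof -
  obtain f' g' where
    f: "\<forall>\<^sub>F s in nhds 0. (f has_real_derivative f' s) (at s)" "(f' has_real_derivative C) (at 0)"
    and g: "\<forall>\<^sub>F s in nhds 0. (g has_real_derivative g' s) (at s)" "(g' has_real_derivative D) (at 0)"
    using assms unfolding second_deriv_at_0_def by blast
  have "\<forall>\<^sub>F s in nhds 0. ((\<lambda>t. f t + g t) has_real_derivative f' s + g' s) (at s)"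
    using f(1) g(1) by eventually_elim (rule DERIV_add)
  with DERIV_add[OF f(2) g(2)] show ?thesis
    unfolding second_deriv_at_0_def by (intro exI[of _ "\<lambda>s. f' s + g' s"] conjI)
qed

lemma second_deriv_at_0_cmult:
  assumes "second_deriv_at_0 f C"
  shows "second_deriv_at_0 (\<lambda>t. c * f t) (c * C)"
proof -
  obtain f' where
    "\<forall>\<^sub>F s in nhds 0. (f has_real_derivative f' s) (at s)" "(f' has_real_derivative C) (at 0)"
    using assms unfolding second_deriv_at_0_def by blast
  then show ?thesis unfolding second_deriv_at_0_def
    by (intro exI[of _ "\<lambda>s. c * f' s"]) (auto elim!: eventually_mono intro!: DERIV_cmult)
qed

lemma second_deriv_at_0_sum:
  assumes "\<And>i. i \<in> I \<Longrightarrow> second_deriv_at_0 (f i) (C i)"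
  shows "second_deriv_at_0 (\<lambda>t. \<Sum>i\<in>I. f i t) (\<Sum>i\<in>I. C i)"
proof -
  \<comment> \<open>Serves the empty index set and also infinite ones, over which a sum is 0 by
    convention.\<close>
  have "second_deriv_at_0 (\<lambda>t. 0) 0"
    unfolding second_deriv_at_0_def by (intro exI[of _ "\<lambda>s. 0"]) auto
  with assms show ?thesis
    by (induction I rule: infinite_finite_induct) (auto intro: second_deriv_at_0_add)
qed

lemma second_deriv_at_0_potential:
  assumes "C3_potential \<phi>" "a > 0"
  shows "second_deriv_at_0 (\<lambda>t. \<phi> (a + t * b)) ((deriv ^^ 2) \<phi> a * b\<^sup>2)"
proof -
  have "((\<lambda>s. a + s * b) \<longlongrightarrow> a + 0 * b) (nhds 0)"
    by (intro tendsto_intros filterlim_ident)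
  then have "\<forall>\<^sub>F s in nhds 0. a + s * b > 0"
    using order_tendstoD(1) assms(2) by fastforce
  then have 1: "\<forall>\<^sub>F s in nhds 0.
      ((\<lambda>t. \<phi> (a + t * b)) has_real_derivative deriv \<phi> (a + s * b) * b) (at s)"
  proof eventually_elim
    case (elim s)
    show ?case
      by (rule DERIV_chain2[where g = "\<lambda>t. a + t * b"])
         (auto intro!: derivative_eq_intros C3_potential_derivs(1) assms elim)
  qed
  have "((\<lambda>s. deriv \<phi> (a + s * b)) has_real_derivative (deriv ^^ 2) \<phi> a * b) (at 0)"
    by (rule DERIV_chain2[where g = "\<lambda>s. a + s * b"])
       (auto intro!: derivative_eq_intros C3_potential_derivs(2) assms)
  from DERIV_cmult_right[OF this, of b]
  have 2: "((\<lambda>s. deriv \<phi> (a + s * b) * b) has_real_derivative (deriv ^^ 2) \<phi> a * b\<^sup>2) (at 0)"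
    by (simp add: power2_eq_square mult.assoc)
  from 1 2 show ?thesis
    unfolding second_deriv_at_0_def by (intro exI[of _ "\<lambda>s. deriv \<phi> (a + s * b) * b"] conjI)
qed

text \<open>With equal directions the two-parameter family depends on \<open>s + t\<close> alone, so
  the iterated directional derivative is the second derivative at 0 of a function of one
  variable.\<close>

lemma second_variation_diag_eq:
  assumes "second_deriv_at_0 (\<lambda>t. E (\<lambda>\<xi>. y \<xi> + t * u \<xi>)) D"
  shows "second_variation E y u u = D"
proof -
  define g where "g = (\<lambda>t. E (\<lambda>\<xi>. y \<xi> + t * u \<xi>))"
  obtain g' where g': "\<forall>\<^sub>F s in nhds 0. (g has_real_derivative g' s) (at s)"
    and D: "(g' has_real_derivative D) (at 0)"
    using assms unfolding second_deriv_at_0_def g_def by blast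
  have eq: "E (\<lambda>\<xi>. y \<xi> + s * u \<xi> + t * u \<xi>) = g (s + t)" for s t
    by (simp add: g_def algebra_simps)
  have "\<forall>\<^sub>F s in nhds 0. deriv (\<lambda>t. g (s + t)) 0 = g' s"
    using g'
  proof eventually_elim
    case (elim s)
    have "((\<lambda>t. g (s + t)) has_real_derivative g' s) (at 0)"
      using elim DERIV_shift[of g "g' s" 0 s] by (simp add: add.commute)
    then show ?case by (rule DERIV_imp_deriv)
  qed
  then have "deriv (\<lambda>s. deriv (\<lambda>t. g (s + t)) 0) 0 = deriv g' 0"
    by (rule deriv_cong_ev) simp
  with D show ?thesis
    by (simp add: second_variation_def eq DERIV_imp_deriv)
qed

lemma bdiff_add_scaled:
  "bdiff N (\<lambda>\<xi>. y \<xi> + t * u \<xi>) \<xi> = bdiff N y \<xi> + t * bdiff N u \<xi>"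
  by (simp add: bdiff_def diff_divide_distrib add_divide_distrib algebra_simps)

lemma second_variation_energy_qc:
  assumes "C3_potential \<phi>" and pos: "\<And>\<xi>. bdiff N y \<xi> > 0"
  shows "second_variation (energy_qc N A \<phi>) y u u =
    eps N * (\<Sum>\<xi>\<in>{1..int N}. (deriv ^^ 2) \<phi> (bdiff N y \<xi>) * (bdiff N u \<xi>)\<^sup>2)
    + eps N * (\<Sum>\<xi>\<in>A. (deriv ^^ 2) \<phi> (bdiff N y \<xi> + bdiff N y (\<xi> + 1))
        * (bdiff N u \<xi> + bdiff N u (\<xi> + 1))\<^sup>2)
    + eps N * (\<Sum>\<xi>\<in>cont_region N A. 1 / 2 *
        ((deriv ^^ 2) \<phi> (2 * bdiff N y \<xi>) * (2 * bdiff N u \<xi>)\<^sup>2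
         + (deriv ^^ 2) \<phi> (2 * bdiff N y (\<xi> + 1)) * (2 * bdiff N u (\<xi> + 1))\<^sup>2))"
proof -
  \<comment> \<open>Every argument of \<phi> is affine in \<open>t\<close>; this brings it to the
    shape \<open>a + t * b\<close> of \<open>second_deriv_at_0_potential\<close>.\<close>
  have reassoc: "a + t * b + (c + t * d) = (a + c) + t * (b + d)"
    "2 * (a + t * b) = 2 * a + t * (2 * b)" for a b c d t :: real
    by (simp_all add: algebra_simps)
  show ?thesis
    by (intro second_variation_diag_eq, unfold energy_qc_def bdiff_add_scaled reassoc)
       (intro second_deriv_at_0_add second_deriv_at_0_cmult second_deriv_at_0_sum
          second_deriv_at_0_potential assms add_pos_pos mult_pos_pos zero_less_numeral)
qed

section \<open>Periodicity and regions\<close>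

lemma bdiff_periodic:
  assumes "y \<in> deformations N F" "N \<ge> 1"
  shows "bdiff N y (\<xi> + int N) = bdiff N y \<xi>"
proof -
  obtain u where u: "y = (\<lambda>\<xi>. F * (eps N * of_int \<xi>) + u \<xi>)" "\<And>\<xi>. u (\<xi> + int N) = u \<xi>"
    using assms(1) by (auto simp: deformations_def mean_zero_periodic_def)
  have "u (\<xi> + int N - 1) = u (\<xi> - 1)" using u(2)[of "\<xi> - 1"] by (simp add: algebra_simps)
  then show ?thesis by (simp add: bdiff_def u algebra_simps)
qed

lemma mean_zero_periodic_bdiff_periodic:
  assumes "u \<in> mean_zero_periodic N"
  shows "bdiff N u (\<xi> + int N) = bdiff N u \<xi>"
proof -
  have p: "u (\<xi> + int N) = u \<xi>" for \<xi> using assms by (auto simp: mean_zero_periodic_def)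
  have "u (\<xi> + int N - 1) = u (\<xi> - 1)" using p[of "\<xi> - 1"] by (simp add: algebra_simps)
  then show ?thesis by (simp add: bdiff_def p)
qed

lemma sum_periodic_pred:
  fixes k :: "int \<Rightarrow> 'a::comm_monoid_add"
  assumes "N \<ge> 1" "\<And>\<xi>. k (\<xi> + int N) = k \<xi>"
  shows "(\<Sum>\<xi>\<in>{1..int N}. k (\<xi> - 1)) = (\<Sum>\<xi>\<in>{1..int N}. k \<xi>)"
proof -
  have "(\<Sum>\<xi>\<in>{1..int N}. k (\<xi> - 1)) = (\<Sum>\<xi>\<in>{0..int N - 1}. k \<xi>)"
    by (rule sum.reindex_bij_witness[of _ "\<lambda>\<xi>. \<xi> + 1" "\<lambda>\<xi>. \<xi> - 1"]) auto
  \<comment> \<open>The shifted window differs from \<open>{1..int N}\<close> only in having 0 in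
    place of \<open>int N\<close>, and periodicity identifies the two values.\<close>
  also have "{0..int N - 1} = insert 0 {1..int N - 1}" using assms(1) by auto
  also have "sum k \<dots> = k (int N) + sum k {1..int N - 1}"
    using assms(2)[of 0] by simp
  also have "\<dots> = sum k (insert (int N) {1..int N - 1})" by simp
  also have "insert (int N) {1..int N - 1} = {1..int N}" using assms(1) by auto
  finally show ?thesis .
qed

text \<open>The expression on the right is the representative of \<xi> modulo \<open>N\<close> in
  \<open>{1..int N}\<close>; plain \<open>mod\<close> would give one in
  \<open>{0..int N - 1}\<close>.\<close>

lemma periodic_ext_iff:
  assumes "A \<subseteq> {1..int N}"
  shows "\<xi> \<in> periodic_ext N A \<longleftrightarrow> (\<xi> - 1) mod int N + 1 \<in> A"
proof
  assume "\<xi> \<in> periodic_ext N A"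
  then obtain a j where a: "a \<in> A" "\<xi> = int N * j + a" by (auto simp: periodic_ext_def)
  then have "\<xi> - 1 = (a - 1) + int N * j" by simp
  then have "(\<xi> - 1) mod int N = (a - 1) mod int N" by (simp only: mod_mult_self2)
  also have "\<dots> = a - 1" using a assms by (intro mod_pos_pos_trivial) auto
  finally show "(\<xi> - 1) mod int N + 1 \<in> A" using a by simp
next
  assume "(\<xi> - 1) mod int N + 1 \<in> A"
  moreover have "\<xi> = int N * ((\<xi> - 1) div int N) + ((\<xi> - 1) mod int N + 1)" by simp
  ultimately show "\<xi> \<in> periodic_ext N A" unfolding periodic_ext_def by blast
qed

lemma periodic_ext_add_period:
  assumes "A \<subseteq> {1..int N}"
  shows "\<xi> + int N \<in> periodic_ext N A \<longleftrightarrow> \<xi> \<in> periodic_ext N A"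
proof -
  have "(\<xi> + int N - 1) mod int N = (\<xi> - 1) mod int N"
    by (metis add_diff_eq add.commute mod_add_self1 diff_add_eq)
  then show ?thesis by (simp add: periodic_ext_iff[OF assms])
qed

lemma periodic_ext_in_period:
  assumes "A \<subseteq> {1..int N}" "\<xi> \<in> {1..int N}"
  shows "\<xi> \<in> periodic_ext N A \<longleftrightarrow> \<xi> \<in> A"
  using assms by (simp add: periodic_ext_iff mod_pos_pos_trivial)

text \<open>Replaces the image under the cyclic successor by a test on the left neighbour. At \<xi>
  = 1 that neighbour is 0, hence the periodic extension.\<close>

lemma iface_l'_iff:
  assumes "A \<subseteq> {1..int N}" "\<xi> \<in> {1..int N}"
  shows "\<xi> \<in> iface_l' N A \<longleftrightarrow> \<xi> \<in> A \<and> \<xi> - 1 \<notin> periodic_ext N A"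
proof
  assume l: "\<xi> \<in> iface_l' N A"
  then obtain \<eta> where \<eta>: "\<eta> \<in> {1..int N}" "\<eta> \<notin> A" "\<xi> = \<eta> mod int N + 1"
    by (auto simp: iface_l'_def iface_l_def cont_region_def)
  have "(\<xi> - 1 - 1) mod int N = (\<eta> - 1) mod int N" by (simp add: \<eta>(3) mod_diff_left_eq)
  with \<eta> have "\<xi> - 1 \<notin> periodic_ext N A"
    by (simp add: periodic_ext_iff[OF assms(1)] mod_pos_pos_trivial)
  then show "\<xi> \<in> A \<and> \<xi> - 1 \<notin> periodic_ext N A"
    using iface_l'_subset[OF assms(1)] l by auto
next
  assume a: "\<xi> \<in> A \<and> \<xi> - 1 \<notin> periodic_ext N A"
  \<comment> \<open>The cyclic predecessor of \<xi> in \<open>{1..int N}\<close>, that is, the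
    representative of \<open>\<xi> - 1\<close>.\<close>
  define \<eta> where "\<eta> = (\<xi> - 2) mod int N + 1"
  have N: "int N > 0" using assms by auto
  have "\<eta> \<notin> A" using a by (simp add: periodic_ext_iff[OF assms(1)] \<eta>_def)
  moreover have "\<eta> \<in> {1..int N}" using N by (simp add: \<eta>_def pos_mod_bound zless_imp_add1_zle)
  moreover have m: "\<eta> mod int N + 1 = \<xi>"
    using assms by (simp add: \<eta>_def mod_add_left_eq mod_pos_pos_trivial)
  moreover have "\<eta> + 1 \<in> periodic_ext N A"
    using a m by (simp add: periodic_ext_iff[OF assms(1)])
  ultimately have "\<eta> \<in> iface_l N A" by (simp add: iface_l_def cont_region_def)
  then show "\<xi> \<in> iface_l' N A" unfolding iface_l'_def using m by force
qed

section \<open>The stability bound\<close>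

text \<open>The four cases are the combinations of two independent choices: whether \<xi> is
  atomistic decides the interaction to the right, whether its left neighbour is atomistic decides
  the one to the left. Each summand can then be traced to a single term of the energy.\<close>

lemma coeff_qc_eq:
  assumes "A \<subseteq> {1..int N}" "\<xi> \<in> {1..int N}"
  shows "coeff_qc N A \<phi> y \<xi> = (deriv ^^ 2) \<phi> (bdiff N y \<xi>)
    + 2 * (if \<xi> \<in> A then (deriv ^^ 2) \<phi> (bdiff N y \<xi> + bdiff N y (\<xi> + 1))
           else (deriv ^^ 2) \<phi> (2 * bdiff N y \<xi>))
    + 2 * (if \<xi> - 1 \<in> periodic_ext N A then (deriv ^^ 2) \<phi> (bdiff N y (\<xi> - 1) + bdiff N y \<xi>)
           else (deriv ^^ 2) \<phi> (2 * bdiff N y \<xi>))"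
  using assms(2)
  by (simp add: coeff_qc_def atom_region'_def iface_l'_iff[OF assms] iface_r'_def iface_r_def
      cont_region_def)

lemma second_variation_energy_qc_ge:
  assumes C3: "C3_potential \<phi>" and r: "r > 0" and conc: "concave_on {r<..} \<phi>"
    and N: "N \<ge> 1" and A: "A \<subseteq> {1..int N}"
    and y: "y \<in> deformations N F" "\<And>\<xi>. bdiff N y \<xi> \<ge> r / 2"
    and u: "u \<in> mean_zero_periodic N"
  shows "second_variation (energy_qc N A \<phi>) y u u
    \<ge> eps N * (\<Sum>\<xi>\<in>{1..int N}. coeff_qc N A \<phi> y \<xi> * (bdiff N u \<xi>)\<^sup>2)"
proof -
  define v where "v = bdiff N u"
  define p where "p = (\<lambda>\<xi>. (deriv ^^ 2) \<phi> (bdiff N y \<xi>))"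
  define B where "B = (\<lambda>\<xi>. (deriv ^^ 2) \<phi> (bdiff N y \<xi> + bdiff N y (\<xi> + 1)))"
  define G where "G = (\<lambda>\<xi>. (deriv ^^ 2) \<phi> (2 * bdiff N y \<xi>))"
  \<comment> \<open>The second-neighbour term of the energy with index \<xi> involves the strains at
    \<xi> and \<xi> + 1; \<open>h \<xi>\<close> and \<open>k \<xi>\<close> are its shares in the
    coefficients of their squares. The coefficient at \<xi> thus collects \<open>h \<xi>\<close> and
    \<open>k (\<xi> - 1)\<close>. As \<open>k\<close> is also evaluated at 0 and has to be periodic,
    it tests membership in the periodic extension.\<close>
  define h where "h = (\<lambda>\<xi>. 2 * (if \<xi> \<in> A then B \<xi> else G \<xi>) * (v \<xi>)\<^sup>2)"
  define k where "k = (\<lambda>\<xi>. 2 * (if \<xi> \<in> periodic_ext N A then B \<xi> else G (\<xi> + 1)) * (v (\<xi> + 1))\<^sup>2)"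
  have pos: "bdiff N y \<xi> > 0" for \<xi> using y(2)[of \<xi>] r by simp
  have sh: "\<xi> + int N + 1 = \<xi> + 1 + int N" for \<xi> by simp
  have "k (\<xi> + int N) = k \<xi>" for \<xi>
    unfolding k_def B_def G_def v_def sh bdiff_periodic[OF y(1) N]
      mean_zero_periodic_bdiff_periodic[OF u] periodic_ext_add_period[OF A] ..
  then have k: "(\<Sum>\<xi>\<in>{1..int N}. k (\<xi> - 1)) = (\<Sum>\<xi>\<in>{1..int N}. k \<xi>)"
    by (rule sum_periodic_pred[OF N])
  have "(\<Sum>\<xi>\<in>{1..int N}. coeff_qc N A \<phi> y \<xi> * (v \<xi>)\<^sup>2)
      = (\<Sum>\<xi>\<in>{1..int N}. p \<xi> * (v \<xi>)\<^sup>2 + h \<xi> + k (\<xi> - 1))"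
    by (rule sum.cong)
       (simp_all add: coeff_qc_eq[OF A] h_def k_def p_def B_def G_def algebra_simps)
  also have "\<dots> = (\<Sum>\<xi>\<in>{1..int N}. p \<xi> * (v \<xi>)\<^sup>2) + (\<Sum>\<xi>\<in>{1..int N}. h \<xi> + k \<xi>)"
    by (simp add: sum.distrib k)
  also have "(\<Sum>\<xi>\<in>{1..int N}. h \<xi> + k \<xi>)
      = (\<Sum>\<xi>\<in>A. h \<xi> + k \<xi>) + (\<Sum>\<xi>\<in>cont_region N A. h \<xi> + k \<xi>)"
    unfolding cont_region_def using sum.subset_diff[OF A, of "\<lambda>\<xi>. h \<xi> + k \<xi>"]
    by (simp add: add.commute)
  \<comment> \<open>The only inequality in the chain: multiplying the bound on the square by the
    nonpositive \<open>B \<xi>\<close> reverses it.\<close>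
  also have "(\<Sum>\<xi>\<in>A. h \<xi> + k \<xi>) \<le> (\<Sum>\<xi>\<in>A. B \<xi> * (v \<xi> + v (\<xi> + 1))\<^sup>2)"
  proof (rule sum_mono)
    fix \<xi> assume \<xi>: "\<xi> \<in> A"
    have "bdiff N y \<xi> + bdiff N y (\<xi> + 1) \<ge> r" using y(2)[of \<xi>] y(2)[of "\<xi> + 1"] by simp
    then have "B \<xi> \<le> 0"
      unfolding B_def by (rule C3_potential_concave_nonpos[OF C3 r conc])
    moreover have "(v \<xi> + v (\<xi> + 1))\<^sup>2 \<le> 2 * (v \<xi>)\<^sup>2 + 2 * (v (\<xi> + 1))\<^sup>2"
      using zero_le_power2[of "v \<xi> - v (\<xi> + 1)"] by (simp add: power2_eq_square algebra_simps)
    ultimately have "B \<xi> * (2 * (v \<xi>)\<^sup>2 + 2 * (v (\<xi> + 1))\<^sup>2) \<le> B \<xi> * (v \<xi> + v (\<xi> + 1))\<^sup>2"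
      by (rule mult_left_mono_neg[rotated])
    then show "h \<xi> + k \<xi> \<le> B \<xi> * (v \<xi> + v (\<xi> + 1))\<^sup>2"
      using \<xi> A periodic_ext_in_period[OF A, of \<xi>] by (auto simp: h_def k_def algebra_simps)
  qed
  \<comment> \<open>Continuum terms are diagonal from the start, with factor 2 from one half times
    the square of 2, so nothing is lost here.\<close>
  also have "(\<Sum>\<xi>\<in>cont_region N A. h \<xi> + k \<xi>) = (\<Sum>\<xi>\<in>cont_region N A. 1 / 2 *
      (G \<xi> * (2 * v \<xi>)\<^sup>2 + G (\<xi> + 1) * (2 * v (\<xi> + 1))\<^sup>2))"
  proof (rule sum.cong)
    fix \<xi> assume "\<xi> \<in> cont_region N A"
    then show "h \<xi> + k \<xi> = 1 / 2 * (G \<xi> * (2 * v \<xi>)\<^sup>2 + G (\<xi> + 1) * (2 * v (\<xi> + 1))\<^sup>2)"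
      using periodic_ext_in_period[OF A, of \<xi>]
      by (simp add: cont_region_def h_def k_def algebra_simps)
  qed simp
  finally have le: "(\<Sum>\<xi>\<in>{1..int N}. coeff_qc N A \<phi> y \<xi> * (v \<xi>)\<^sup>2) \<le>
      (\<Sum>\<xi>\<in>{1..int N}. p \<xi> * (v \<xi>)\<^sup>2) + ((\<Sum>\<xi>\<in>A. B \<xi> * (v \<xi> + v (\<xi> + 1))\<^sup>2)
      + (\<Sum>\<xi>\<in>cont_region N A. 1 / 2 * (G \<xi> * (2 * v \<xi>)\<^sup>2 + G (\<xi> + 1) * (2 * v (\<xi> + 1))\<^sup>2)))"
    by simp
  have "eps N \<ge> 0" by (simp add: eps_def)
  from mult_left_mono[OF le this] show ?thesis
    unfolding second_variation_energy_qc[OF C3 pos]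
    by (simp only: v_def p_def B_def G_def distrib_left add.assoc)
qed

lemma stability_const_energy_qc_ge:
  assumes "C3_potential \<phi>" "r > 0" "concave_on {r<..} \<phi>" "N \<ge> 1" "A \<subseteq> {1..int N}"
    and "y \<in> deformations N F" "\<And>\<xi>. bdiff N y \<xi> \<ge> r / 2"
  shows "stability_const N (energy_qc N A \<phi>) y
    \<ge> ereal (Min (coeff_qc N A \<phi> y ` {1..int N}))"
  unfolding stability_const_def
proof (rule INF_greatest)
  fix u assume "u \<in> {u \<in> mean_zero_periodic N. norm_U12 N u = 1}"
  then have u: "u \<in> mean_zero_periodic N"
    and norm: "eps N * (\<Sum>\<xi>\<in>{1..int N}. (bdiff N u \<xi>)\<^sup>2) = 1"
    by (auto simp: norm_U12_def)
  define m where "m = Min (coeff_qc N A \<phi> y ` {1..int N})"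
  \<comment> \<open>The normalisation of \<open>u\<close> writes the minimum as a weighted sum of
    squares, which is then compared coefficient by coefficient.\<close>
  have "m = eps N * (\<Sum>\<xi>\<in>{1..int N}. m * (bdiff N u \<xi>)\<^sup>2)"
    using norm by (simp add: sum_distrib_left[symmetric] mult.left_commute)
  also have "\<dots> \<le> eps N * (\<Sum>\<xi>\<in>{1..int N}. coeff_qc N A \<phi> y \<xi> * (bdiff N u \<xi>)\<^sup>2)"
    by (intro mult_left_mono sum_mono mult_right_mono) (auto simp: m_def eps_def)
  also have "\<dots> \<le> second_variation (energy_qc N A \<phi>) y u u"
    by (rule second_variation_energy_qc_ge[OF assms u])
  finally show "ereal m \<le> ereal (second_variation (energy_qc N A \<phi>) y u u)" by simp
qed

lemma energy_eq_energy_qc: "energy N \<phi> = energy_qc N {1..int N} \<phi>"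
  by (simp add: fun_eq_iff energy_def energy_qc_def cont_region_def sum.distrib algebra_simps)

text \<open>An empty continuum region leaves no interface, so every index of the period falls into
  the purely atomistic branch.\<close>

lemma coeff_at_eq_coeff_qc: "coeff_at N \<phi> y \<xi> = coeff_qc N {1..int N} \<phi> y \<xi>"
  if "\<xi> \<in> {1..int N}"
  using that by (simp add: coeff_at_def coeff_qc_def atom_region'_def iface_l'_def iface_l_def
      cont_region_def)

theorem mainTheorem5:
  fixes N :: nat and F r :: real and \<phi> :: "real \<Rightarrow> real"
    and A :: "int set" and y :: "int \<Rightarrow> real"
  assumes "N \<ge> 1" and "F > 0"
    and "C3_potential \<phi>"
    and "r > 0" and "convex_on {0<..<r} \<phi>" and "concave_on {r<..} \<phi>"
    and "A \<subseteq> {1..int N}" and "iface_l N A \<inter> iface_r N A = {}"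
    and "y \<in> deformations N F"
    and "\<forall>\<xi>. bdiff N y \<xi> \<ge> r / 2"
  shows "stability_const N (energy N \<phi>) y
           \<ge> ereal (Min (coeff_at N \<phi> y ` {1..int N})) \<and>
         stability_const N (energy_qc N A \<phi>) y
           \<ge> ereal (Min (coeff_qc N A \<phi> y ` {1..int N}))"
proof -
  \<comment> \<open>Stated for an arbitrary region because it is used twice: with
    \<open>{1..int N}\<close> for the atomistic bound and with \<open>A\<close> for the
    quasicontinuum bound.\<close>
  have qc: "stability_const N (energy_qc N A' \<phi>) y
      \<ge> ereal (Min (coeff_qc N A' \<phi> y ` {1..int N}))" if "A' \<subseteq> {1..int N}" for A'
    using stability_const_energy_qc_ge[OF assms(3,4,6,1) that assms(9)] assms(10) by blast
  have "coeff_at N \<phi> y ` {1..int N} = coeff_qc N {1..int N} \<phi> y ` {1..int N}"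
    by (rule image_cong) (simp_all add: coeff_at_eq_coeff_qc)
  then show ?thesis
    using qc[of "{1..int N}"] qc[OF assms(7)] by (simp add: energy_eq_energy_qc)
qed

end
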